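(* Let $H_1,H_2,H_4,H_5$ be Hilbert spaces over the same field ($\mathbb{R}$ or $\mathbb{C}$), and let $A_1\in\mathcal{L}_c(H_1,H_4)$, $A_2\in\mathcal{L}_c(H_1,H_5)$, $B_1\in\mathcal{L}_c(H_2,H_4)$, $B_2\in\mathcal{L}_c(H_2,H_5)$. The following statements are equivalent: (i) For any $h_1\in H_1$ and any $\varepsilon>0$, there exists $h_2\in H_2$ such that $A_1h_1=B_1h_2$ and $\|A_2h_1-B_2h_2\|_5\leqslant\varepsilon$. (ii) The two following conditions hold: (a) there exists $C>0$ such that for any $h_4\in H_4$, $\|A_1^*h_4\|_1\leqslant C\|B_1^*h_4\|_2$; (b) for any $h_5\in H_5$ and any sequence $(y_n)_{n\in\mathbb{N}^*}$ in $H_4$ such that $B_2^*h_5=\lim_{n\to+\infty}B_1^*y_n$, one has $A_2^*h_5=\lim_{n\to+\infty}A_1^*y_n$. (iii) Denoting by $\Pi$ the orthogonal projection on $\mathcal{N}(B_1)$ in $H_2$, there exist $D_1\in\mathcal{L}_c(H_2,H_1)$ and $D_2\in\mathcal{L}(\mathcal{N}(B_1),H_1)$ (not necessarily continuous) such that $A_1^*=D_1B_1^*$ and $A_2^*=(D_1+D_2\Pi)B_2^*$.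
   Context: $\mathcal{L}_c(E,F)$ denotes the set of continuous linear maps from $E$ to $F$; $\mathcal{L}(E,F)$ denotes the set of all linear maps from $E$ to $F$, not necessarily continuous. $\mathcal{N}(T)$ is the kernel of $T$, $T^*$ is the Hilbert space adjoint of $T$, $\|\cdot\|_i$ is the norm of $H_i$, and $\mathbb{N}^*=\{1,2,\dots\}$. In $D_2\Pi$, the projection $\Pi$ is regarded as a map from $H_2$ to $\mathcal{N}(B_1)$. *)

theory Defs
  imports "HOL-Analysis.Analysis"
begin

text \<open>
  The scalar field. The axioms leave, up to isomorphism, exactly the two possibilities
  \<open>\<real>\<close> and \<open>\<complex>\<close> (lemma \<open>real_or_complex_cases\<close>).
\<close>

class real_or_complex = real_normed_field +
  fixes scalar_cnj :: "'a \<Rightarrow> 'a"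
  assumes scalar_cnj_add: "scalar_cnj (x + y) = scalar_cnj x + scalar_cnj y"
    and scalar_cnj_mult: "scalar_cnj (x * y) = scalar_cnj x * scalar_cnj y"
    and scalar_cnj_scaleR_one: "scalar_cnj (r *\<^sub>R 1) = r *\<^sub>R 1"
    and mult_scalar_cnj_scaleR: "x * scalar_cnj x = (norm x)\<^sup>2 *\<^sub>R 1"

lemma scalar_cnj_of_real: "scalar_cnj (of_real r :: 'k::real_or_complex) = of_real r"
  by (simp add: of_real_def scalar_cnj_scaleR_one)

lemma mult_scalar_cnj: "(x :: 'k::real_or_complex) * scalar_cnj x = of_real ((norm x)\<^sup>2)"
  by (simp add: of_real_def mult_scalar_cnj_scaleR)

instantiation real :: real_or_complex
begin
definition scalar_cnj_real :: "real \<Rightarrow> real" where "scalar_cnj_real x = x"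
instance by standard (simp_all add: scalar_cnj_real_def power2_eq_square)
end

instantiation complex :: real_or_complex
begin
definition scalar_cnj_complex :: "complex \<Rightarrow> complex" where "scalar_cnj_complex = cnj"
instance
  by standard
    (simp_all only: scalar_cnj_complex_def scaleR_conv_of_real complex_norm_square[symmetric],
      simp_all)
end

lemma scalar_add_cnj_real:
  fixes x :: "'k::real_or_complex"
  obtains r where "x + scalar_cnj x = of_real r"
proof
  have "(x + 1) * scalar_cnj (x + 1) = x * scalar_cnj x + (x + scalar_cnj x) + 1"
    using scalar_cnj_of_real[of 1, where 'k='k]
    by (simp add: scalar_cnj_add algebra_simps)
  then show "x + scalar_cnj x = of_real ((norm (x + 1))\<^sup>2 - (norm x)\<^sup>2 - 1)"
    by (simp add: mult_scalar_cnj algebra_simps)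
qed

lemma real_or_complex_cases:
  "(\<forall>x::'k::real_or_complex. \<exists>a. x = of_real a) \<or>
   (\<exists>i::'k. i * i = - 1 \<and> (\<forall>x. \<exists>a b. x = of_real a + of_real b * i))"
proof (cases "\<forall>x::'k. \<exists>a. x = of_real a")
  case False
  have fixed: "\<exists>a. z = of_real a" if "scalar_cnj z = z" for z :: 'k
  proof -
    obtain r where "z + scalar_cnj z = of_real r" by (rule scalar_add_cnj_real)
    then have "z = of_real (r / 2)" using that by (simp add: field_simps)
    then show ?thesis ..
  qed
  have split: "\<exists>a y. x = of_real a + y \<and> scalar_cnj y = - y" for x :: 'k
  proof -
    obtain r where r: "x + scalar_cnj x = of_real r" by (rule scalar_add_cnj_real)
    have "scalar_cnj (x - of_real (r / 2)) = scalar_cnj x - of_real (r / 2)"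
      using scalar_cnj_add[of x "of_real (- (r / 2))"] scalar_cnj_of_real[of "- (r / 2)", where 'k='k]
      by simp
    also have "\<dots> = - (x - of_real (r / 2))"
      by (simp add: r[symmetric] field_simps)
    finally show ?thesis
      by (intro exI[of _ "r / 2"] exI[of _ "x - of_real (r / 2)"]) simp
  qed
  from False obtain x0 :: 'k where x0: "\<nexists>a. x0 = of_real a" by blast
  obtain a0 y0 where y0: "x0 = of_real a0 + y0" "scalar_cnj y0 = - y0" using split by blast
  have nz: "y0 \<noteq> 0" using x0 y0(1) by auto
  define i where "i = y0 * of_real (1 / norm y0)"
  have cnj_i: "scalar_cnj i = - i"
    by (simp only: i_def scalar_cnj_mult scalar_cnj_of_real y0(2)) simp
  have "norm i = 1" using nz by (simp add: i_def norm_divide)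
  then have ii: "i * i = - 1"
    using mult_scalar_cnj[of i] cnj_i by (simp add: minus_equation_iff)
  have "\<exists>a b. x = of_real a + of_real b * i" for x :: 'k
  proof -
    obtain a y where y: "x = of_real a + y" "scalar_cnj y = - y" using split by blast
    have "scalar_cnj (y * i) = y * i" by (simp add: scalar_cnj_mult y(2) cnj_i)
    then obtain b where b: "y * i = of_real b" using fixed by blast
    have "y = - (y * (i * i))" using ii by simp
    also have "\<dots> = of_real (- b) * i" using b by (simp add: mult.assoc[symmetric])
    finally show ?thesis using y(1) by blast
  qed
  with ii show ?thesis by blast
qed simp

text \<open>
  A Hilbert space over the field \<open>'k\<close>: norm, topology and completeness are those of the
  type class \<^class>\<open>banach\<close>, and \<open>ip\<close> is an inner product over \<open>'k\<close>
  (linear in the first argument, conjugate-linear in the second) inducing this norm.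
\<close>

locale hilbert_space = vector_space scale
  for scale :: "'k::real_or_complex \<Rightarrow> 'h::banach \<Rightarrow> 'h" +
  fixes ip :: "'h \<Rightarrow> 'h \<Rightarrow> 'k"
  assumes scale_of_real: "scale (of_real r) x = r *\<^sub>R x"
    and ip_add_left: "ip (x + y) z = ip x z + ip y z"
    and ip_scale_left: "ip (scale c x) y = c * ip x y"
    and ip_commute: "ip y x = scalar_cnj (ip x y)"
    and ip_self: "ip x x = of_real ((norm x)\<^sup>2)"

lemma hilbert_space_real_inner:
  "hilbert_space (scaleR :: real \<Rightarrow> 'h::{real_inner, banach} \<Rightarrow> 'h) inner"
  by unfold_locales
    (simp_all add: scaleR_add_right scaleR_add_left inner_add_left scalar_cnj_real_def
      power2_norm_eq_inner, simp add: inner_commute)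

lemma hilbert_space_complex: "hilbert_space (*) (\<lambda>x y :: complex. x * cnj y)"
  by unfold_locales
    (simp_all only: complex_norm_square[symmetric] scalar_cnj_complex_def scaleR_conv_of_real,
      simp_all add: algebra_simps)

definition continuous_linear ::
  "('k::field \<Rightarrow> 'a \<Rightarrow> 'a::real_normed_vector) \<Rightarrow> ('k \<Rightarrow> 'b \<Rightarrow> 'b::real_normed_vector)
    \<Rightarrow> ('a \<Rightarrow> 'b) \<Rightarrow> bool"
  where "continuous_linear s1 s2 f \<longleftrightarrow> Vector_Spaces.linear s1 s2 f \<and> continuous_on UNIV f"

text \<open>
  A linear map defined on a subspace \<open>S\<close> only is represented by a total function whose
  values outside \<open>S\<close> are irrelevant.
\<close>

definition linear_on_subspace ::
  "('k \<Rightarrow> 'a \<Rightarrow> 'a::plus) \<Rightarrow> ('k \<Rightarrow> 'b \<Rightarrow> 'b::plus) \<Rightarrow> 'a set \<Rightarrow> ('a \<Rightarrow> 'b) \<Rightarrow> bool"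
  where "linear_on_subspace s1 s2 S f \<longleftrightarrow>
    (\<forall>x\<in>S. \<forall>y\<in>S. f (x + y) = f x + f y) \<and> (\<forall>c. \<forall>x\<in>S. f (s1 c x) = s2 c (f x))"

definition hilbert_adjoint ::
  "('a \<Rightarrow> 'a \<Rightarrow> 'k) \<Rightarrow> ('b \<Rightarrow> 'b \<Rightarrow> 'k) \<Rightarrow> ('a \<Rightarrow> 'b) \<Rightarrow> 'b \<Rightarrow> 'a"
  where "hilbert_adjoint ip1 ip2 T = (THE T'. \<forall>x y. ip2 (T x) y = ip1 x (T' y))"

definition null_space :: "('a \<Rightarrow> 'b::zero) \<Rightarrow> 'a set"
  where "null_space T = {x. T x = 0}"

definition orthogonal_projection ::
  "('a::minus \<Rightarrow> 'a \<Rightarrow> 'k::zero) \<Rightarrow> 'a set \<Rightarrow> 'a \<Rightarrow> 'a"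
  where "orthogonal_projection ip S x = (THE p. p \<in> S \<and> (\<forall>s\<in>S. ip (x - p) s = 0))"

end

theory Submission
  imports Defs
begin

text \<open>
  Write \<open>\<Pi>\<close> for the orthogonal projection on the kernel of \<open>B1\<close>; its kernel is the closure of the
  range of \<open>B1\<^sup>*\<close>. The three statements are proved in a cycle.

  From (i) to (ii): \<open>A1 h1 = B1 h2\<close> bounds \<open>\<langle>h1, A1\<^sup>* h4\<rangle> = \<langle>h2, B1\<^sup>* h4\<rangle>\<close> by \<open>norm h2\<close> as long as
  \<open>norm (B1\<^sup>* h4) \<le> 1\<close>, and the uniform boundedness principle turns these bounds, one for each \<open>h1\<close>,
  into (a) (lemma \<open>adj_norm_le_if_range_subset\<close>). If \<open>B1\<^sup>* (y n)\<close> converges to \<open>B2\<^sup>* h5\<close>, then by (a)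
  \<open>A1\<^sup>* (y n)\<close> has a limit, and testing against each \<open>h1\<close> with its approximate solutions \<open>h2\<close>
  identifies this limit as \<open>A2\<^sup>* h5\<close> (lemma \<open>adj_limit_if_approx_solvable\<close>).

  From (ii) to (iii): by (a), \<open>B1\<^sup>* h4 \<mapsto> A1\<^sup>* h4\<close> is a bounded map on the range of \<open>B1\<^sup>*\<close>; \<open>D1\<close> is
  its continuous extension to the closure of the range, and \<open>0\<close> on the orthogonal complement (lemma
  \<open>continuous_factor_if_norm_le\<close>). By (b), \<open>A2\<^sup>* - D1 B2\<^sup>*\<close> vanishes wherever \<open>\<Pi> B2\<^sup>*\<close> does, so it
  factors through \<open>\<Pi> B2\<^sup>*\<close>, by purely linear algebra (lemma \<open>linear_factor_if_kernel_subset\<close>). Nothing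
  bounds the second factor \<open>D2\<close>, which is why it need not be continuous.

  From (iii) to (i): \<open>A1 = B1 D1\<^sup>*\<close>, so \<open>D1\<^sup>* h1 + n\<close> solves the exact equation for every \<open>n\<close> in the
  kernel of \<open>B1\<close>. The error \<open>A2 h1 - B2 (D1\<^sup>* h1)\<close> lies in the closure of the image of this kernel
  under \<open>B2\<close>, because the orthogonal complement of that image consists of the \<open>h5\<close> with
  \<open>\<Pi> (B2\<^sup>* h5) = 0\<close>, and for them \<open>A2\<^sup>* h5 = D1 (B2\<^sup>* h5)\<close> (lemma \<open>approx_solvable_if_factorization\<close>).
\<close>

section \<open>Geometry of a Hilbert space\<close>

context hilbert_space
begin

lemma ip_add_right: "ip x (y + z) = ip x y + ip x z"
  by (metis ip_add_left ip_commute scalar_cnj_add)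

lemma ip_scale_right: "ip x (scale c y) = scalar_cnj c * ip x y"
  by (metis ip_scale_left ip_commute scalar_cnj_mult)

lemma ip_zero_left [simp]: "ip 0 x = 0"
  using ip_add_left[of 0 0 x] by simp

lemma ip_zero_right [simp]: "ip x 0 = 0"
  using ip_add_right[of x 0 0] by simp

lemma ip_diff_left: "ip (x - y) z = ip x z - ip y z"
  using ip_add_left[of "x - y" y z] by (simp add: algebra_simps)

lemma ip_diff_right: "ip x (y - z) = ip x y - ip x z"
  using ip_add_right[of x "y - z" z] by (simp add: algebra_simps)

lemma ip_eq_zero_commute: "ip x y = 0 \<longleftrightarrow> ip y x = 0"
  by (metis ip_commute ip_zero_left ip_zero_right)

lemma ip_self_eq_zero: "ip x x = 0 \<longleftrightarrow> x = 0"
  by (simp add: ip_self)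

lemma eq_if_ip_eq:
  assumes "\<And>z. ip x z = ip y z"
  shows "x = y"
proof -
  have "ip (x - y) (x - y) = 0"
    unfolding ip_diff_left using assms by simp
  then show ?thesis by (simp add: ip_self_eq_zero)
qed

lemma norm_scale: "norm (scale c x) = norm c * norm x"
proof -
  have "(of_real ((norm (scale c x))\<^sup>2) :: 'k) = c * scalar_cnj c * ip x x"
    by (simp only: ip_self[symmetric] ip_scale_left ip_scale_right mult.left_commute mult.assoc)
  also have "\<dots> = of_real ((norm c * norm x)\<^sup>2)"
    by (simp only: mult_scalar_cnj ip_self of_real_mult[symmetric] power_mult_distrib)
  finally have "(norm (scale c x))\<^sup>2 = (norm c * norm x)\<^sup>2"
    by (simp only: of_real_eq_iff)
  then show ?thesis by simp
qed

lemma bounded_linear_scale: "bounded_linear (scale c)"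
proof (rule bounded_linear_intro)
  show "norm (scale c x) \<le> norm x * norm c" for x
    by (simp add: norm_scale mult.commute)
  show "scale c (r *\<^sub>R x) = r *\<^sub>R scale c x" for r x
    by (metis mult.commute scale_of_real scale_scale)
qed (rule scale_right_distrib)

lemma parallelogram:
  fixes x y :: 'h
  shows "(norm (x + y))\<^sup>2 + (norm (x - y))\<^sup>2 = 2 * (norm x)\<^sup>2 + 2 * (norm y)\<^sup>2"
proof -
  have "ip (x + y) (x + y) + ip (x - y) (x - y) = 2 * ip x x + 2 * ip y y"
    by (simp add: ip_add_left ip_add_right ip_diff_left ip_diff_right)
  then have "(of_real ((norm (x + y))\<^sup>2 + (norm (x - y))\<^sup>2) :: 'k)
      = of_real (2 * (norm x)\<^sup>2 + 2 * (norm y)\<^sup>2)"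
    by (simp only: ip_self of_real_add of_real_mult of_real_numeral)
  then show ?thesis by (simp only: of_real_eq_iff)
qed

text \<open>
  Removing from \<open>x\<close> its component along \<open>y\<close> lowers the squared norm by exactly the amount
  below. That amount cannot exceed \<open>(norm x)\<^sup>2\<close>, which is the Cauchy--Schwarz inequality, and it
  vanishes when subtracting a multiple of \<open>y\<close> cannot shorten \<open>x\<close>, which makes nearest points
  orthogonal projections.
\<close>

lemma norm_remove_component:
  assumes "y \<noteq> 0"
  shows "(norm (x - scale (ip x y / of_real ((norm y)\<^sup>2)) y))\<^sup>2
    = (norm x)\<^sup>2 - (norm (ip x y))\<^sup>2 / (norm y)\<^sup>2"
proof -
  define N where "N = (norm y)\<^sup>2"
  have N: "N \<noteq> 0" using assms by (simp add: N_def)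
  define c where "c = ip x y * of_real (1 / N)"
  have c': "ip x y / of_real ((norm y)\<^sup>2) = c"
    by (simp add: c_def N_def divide_inverse)
  have cc: "scalar_cnj c = ip y x * of_real (1 / N)"
    unfolding c_def scalar_cnj_mult scalar_cnj_of_real ip_commute[of y x] ..
  have prod: "ip x y * ip y x = of_real ((norm (ip x y))\<^sup>2)"
    unfolding ip_commute[of y x] by (rule mult_scalar_cnj)
  have yy: "ip y y = of_real N" by (simp add: ip_self N_def)
  have "ip (x - scale c y) (x - scale c y)
      = ip x x - scalar_cnj c * ip x y - c * ip y x + c * (scalar_cnj c * ip y y)"
    by (simp add: ip_diff_left ip_diff_right ip_scale_left ip_scale_right algebra_simps)
  also have "\<dots> = ip x x - (ip x y * ip y x) * of_real (1 / N)"
    using N unfolding yy cc c_def by (simp add: field_simps)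
  also have "\<dots> = of_real ((norm x)\<^sup>2 - (norm (ip x y))\<^sup>2 / N)"
    unfolding prod ip_self by simp
  finally show ?thesis
    unfolding c' ip_self N_def by (simp only: of_real_eq_iff)
qed

lemma cauchy_schwarz: "norm (ip x y) \<le> norm x * norm y"
proof (cases "y = 0")
  case False
  have "0 \<le> (norm x)\<^sup>2 - (norm (ip x y))\<^sup>2 / (norm y)\<^sup>2"
    unfolding norm_remove_component[OF False, symmetric] by simp
  then have "(norm (ip x y))\<^sup>2 \<le> (norm x * norm y)\<^sup>2"
    using False by (simp add: field_simps power_mult_distrib)
  then show ?thesis by (rule power2_le_imp_le) simp
qed simp

lemma bounded_linear_ip_left: "bounded_linear (\<lambda>x. ip x y)"
proof (rule bounded_linear_intro)
  show "ip (r *\<^sub>R x) y = r *\<^sub>R ip x y" for r x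
    by (simp add: scale_of_real[symmetric] ip_scale_left scaleR_conv_of_real)
qed (rule ip_add_left, rule cauchy_schwarz)

lemma bounded_linear_ip_right: "bounded_linear (ip x)"
proof (rule bounded_linear_intro)
  show "ip x (r *\<^sub>R y) = r *\<^sub>R ip x y" for r y
    by (simp add: scale_of_real[symmetric] ip_scale_right scalar_cnj_of_real scaleR_conv_of_real)
  show "norm (ip x y) \<le> norm y * norm x" for y
    using cauchy_schwarz[of x y] by (simp add: mult.commute)
qed (rule ip_add_right)

lemma subspace_closure:
  assumes "subspace M"
  shows "subspace (closure M)"
proof (rule subspaceI)
  show "0 \<in> closure M"
    using subspace_0[OF assms] closure_subset by blast
  show "x + y \<in> closure M" if "x \<in> closure M" "y \<in> closure M" for x y
  proof -
    from that obtain u v where "\<And>n. u n \<in> M" "u \<longlonglongrightarrow> x" "\<And>n. v n \<in> M" "v \<longlonglongrightarrow> y"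
      unfolding closure_sequential by blast
    then have "(\<forall>n. u n + v n \<in> M) \<and> (\<lambda>n. u n + v n) \<longlonglongrightarrow> x + y"
      by (simp add: subspace_add[OF assms] tendsto_add)
    then show ?thesis unfolding closure_sequential by (rule exI[of _ "\<lambda>n. u n + v n"])
  qed
  show "scale c x \<in> closure M" if "x \<in> closure M" for c x
  proof -
    from that obtain u where "\<And>n. u n \<in> M" "u \<longlonglongrightarrow> x"
      unfolding closure_sequential by blast
    then have "(\<forall>n. scale c (u n) \<in> M) \<and> (\<lambda>n. scale c (u n)) \<longlonglongrightarrow> scale c x"
      by (simp add: subspace_scale[OF assms] bounded_linear.tendsto[OF bounded_linear_scale])
    then show ?thesis unfolding closure_sequential by (rule exI[of _ "\<lambda>n. scale c (u n)"])
  qed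
qed

subsection \<open>Orthogonal projection\<close>

text \<open>
  By the parallelogram law two points of \<open>S\<close> that are nearly closest to \<open>x\<close> are near each
  other, because their midpoint is again in \<open>S\<close>; hence a minimizing sequence is Cauchy.
\<close>

lemma nearest_point:
  assumes "closed S" "subspace S"
  obtains p where "p \<in> S" "\<And>s. s \<in> S \<Longrightarrow> norm (x - p) \<le> norm (x - s)"
proof -
  have ne: "S \<noteq> {}" using subspace_0[OF assms(2)] by blast
  define d where "d = infdist x S"
  have d0: "0 \<le> d" unfolding d_def by (rule infdist_nonneg)
  have d: "d \<le> norm (x - s)" if "s \<in> S" for s
    using infdist_le[OF that, of x] by (simp add: d_def dist_norm)
  have "\<exists>s\<in>S. norm (x - s) < d + 1 / Suc n" for n
  proof (rule ccontr)
    assume "\<not> ?thesis"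
    then have "d + 1 / Suc n \<le> d"
      unfolding d_def infdist_notempty[OF ne]
      by (intro cINF_greatest[OF ne]) (auto simp: dist_norm not_less infdist_notempty[OF ne])
    then show False by simp
  qed
  then obtain s where s: "\<And>n. s n \<in> S" "\<And>n. norm (x - s n) < d + 1 / Suc n" by metis
  have gap: "(norm (s m - s n))\<^sup>2 \<le> 4 * ((d + 1 / Suc N)\<^sup>2 - d\<^sup>2)" if "N \<le> m" "N \<le> n" for m n N
  proof -
    have near: "(norm (x - s k))\<^sup>2 \<le> (d + 1 / Suc N)\<^sup>2" if "N \<le> k" for k
    proof (rule power_mono)
      have "1 / real (Suc k) \<le> 1 / real (Suc N)" using that by (simp add: frac_le)
      then show "norm (x - s k) \<le> d + 1 / Suc N" using s(2)[of k] by linarith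
    qed simp
    have mid: "scale (of_real (1/2)) (s m + s n) \<in> S"
      by (intro subspace_scale subspace_add assms s)
    have "(x - s n) + (x - s m) = 2 *\<^sub>R (x - scale (of_real (1/2)) (s m + s n))"
      by (simp only: scale_of_real) (simp add: algebra_simps scaleR_2)
    then have "norm ((x - s n) + (x - s m)) = 2 * norm (x - scale (of_real (1/2)) (s m + s n))"
      by simp
    then have "2 * d \<le> norm ((x - s n) + (x - s m))"
      using d[OF mid] by linarith
    then have "(2 * d)\<^sup>2 \<le> (norm ((x - s n) + (x - s m)))\<^sup>2"
      using d0 by (intro power_mono) auto
    moreover have "(norm ((x - s n) + (x - s m)))\<^sup>2 + (norm (s m - s n))\<^sup>2
        = 2 * (norm (x - s n))\<^sup>2 + 2 * (norm (x - s m))\<^sup>2"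
      using parallelogram[of "x - s n" "x - s m"] by simp
    ultimately show ?thesis
      using near[OF that(1)] near[OF that(2)] by (simp add: power_mult_distrib)
  qed
  have lim: "(\<lambda>N. 1 / real (Suc N)) \<longlonglongrightarrow> 0"
    using LIMSEQ_inverse_real_of_nat by (simp add: inverse_eq_divide)
  have "(\<lambda>N. 4 * ((d + 1 / real (Suc N))\<^sup>2 - d\<^sup>2)) \<longlonglongrightarrow> 4 * ((d + 0)\<^sup>2 - d\<^sup>2)"
    by (intro tendsto_intros lim)
  then have gap_lim: "(\<lambda>N. 4 * ((d + 1 / real (Suc N))\<^sup>2 - d\<^sup>2)) \<longlonglongrightarrow> 0" by simp
  have "Cauchy s"
  proof (rule CauchyI)
    fix e :: real assume "0 < e"
    then have "eventually (\<lambda>N. 4 * ((d + 1 / real (Suc N))\<^sup>2 - d\<^sup>2) < e\<^sup>2) sequentially"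
      by (intro order_tendstoD(2)[OF gap_lim]) simp
    then obtain N where "4 * ((d + 1 / real (Suc N))\<^sup>2 - d\<^sup>2) < e\<^sup>2"
      by (auto simp: eventually_sequentially)
    then have "(norm (s m - s n))\<^sup>2 < e\<^sup>2" if "N \<le> m" "N \<le> n" for m n
      using gap[OF that] by linarith
    then show "\<exists>M. \<forall>m\<ge>M. \<forall>n\<ge>M. norm (s m - s n) < e"
      using \<open>0 < e\<close> by (meson less_imp_le power_less_imp_less_base)
  qed
  then obtain p where p: "s \<longlonglongrightarrow> p"
    using Cauchy_convergent_iff convergent_def by blast
  have "p \<in> S" using closed_sequentially[OF assms(1) s(1) p] .
  moreover have "norm (x - p) \<le> d"
  proof (rule LIMSEQ_le)
    show "(\<lambda>n. norm (x - s n)) \<longlonglongrightarrow> norm (x - p)" by (intro tendsto_intros p)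
    show "(\<lambda>n. d + 1 / Suc n) \<longlonglongrightarrow> d"
      using tendsto_add[OF tendsto_const lim, of d] by simp
    show "\<exists>N. \<forall>n\<ge>N. norm (x - s n) \<le> d + 1 / Suc n"
      using s(2) less_imp_le by blast
  qed
  ultimately show ?thesis using that d by (meson order_trans)
qed

lemma orthogonal_projection_eqI:
  assumes "subspace S" "p \<in> S" "\<And>s. s \<in> S \<Longrightarrow> ip (x - p) s = 0"
  shows "orthogonal_projection ip S x = p"
  unfolding orthogonal_projection_def
proof (rule the_equality)
  show "q = p" if "q \<in> S \<and> (\<forall>s\<in>S. ip (x - q) s = 0)" for q
  proof -
    have "q - p \<in> S" using that assms by (simp add: subspace_diff)
    then have "ip ((x - p) - (x - q)) (q - p) = 0"
      unfolding ip_diff_left[of "x - p"] using that assms by simp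
    then show ?thesis by (simp add: ip_self_eq_zero)
  qed
qed (use assms in blast)

lemma
  assumes "closed S" "subspace S"
  shows orthogonal_projection_in: "orthogonal_projection ip S x \<in> S"
    and orthogonal_projection_orthogonal:
      "s \<in> S \<Longrightarrow> ip (x - orthogonal_projection ip S x) s = 0"
proof -
  obtain p where p: "p \<in> S" "\<And>s. s \<in> S \<Longrightarrow> norm (x - p) \<le> norm (x - s)"
    using nearest_point[OF assms] by blast
  have orth: "ip (x - p) s = 0" if "s \<in> S" for s
  proof (cases "s = 0")
    case False
    let ?c = "ip (x - p) s / of_real ((norm s)\<^sup>2)"
    have "p + scale ?c s \<in> S"
      using assms(2) p(1) that by (intro subspace_add subspace_scale)
    then have "norm (x - p) \<le> norm (x - (p + scale ?c s))" by (rule p(2))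
    then have "norm (x - p) \<le> norm (x - p - scale ?c s)" by (simp only: diff_diff_eq)
    then have "(norm (x - p))\<^sup>2 \<le> (norm (x - p - scale ?c s))\<^sup>2" by (rule power_mono) simp
    then have "(norm (ip (x - p) s))\<^sup>2 / (norm s)\<^sup>2 \<le> 0"
      unfolding norm_remove_component[OF False] by simp
    then show ?thesis using False by (simp add: divide_le_0_iff)
  qed simp
  have "orthogonal_projection ip S x = p"
    using orthogonal_projection_eqI[OF assms(2) p(1)] orth by blast
  with p(1) orth
  show "orthogonal_projection ip S x \<in> S"
    and "s \<in> S \<Longrightarrow> ip (x - orthogonal_projection ip S x) s = 0" by simp_all
qed

lemma linear_orthogonal_projection:
  assumes "closed S" "subspace S"
  shows "Vector_Spaces.linear scale scale (orthogonal_projection ip S)"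
  unfolding Vector_Spaces.linear_iff
proof (intro conjI allI vector_space_axioms)
  note P = orthogonal_projection_in[OF assms] orthogonal_projection_orthogonal[OF assms]
  let ?P = "orthogonal_projection ip S"
  fix x y c
  have "ip (x + y - (?P x + ?P y)) s = 0" if "s \<in> S" for s
    using ip_add_left[of "x - ?P x" "y - ?P y" s] P(2)[OF that] by (simp add: algebra_simps)
  then show "?P (x + y) = ?P x + ?P y"
    by (intro orthogonal_projection_eqI assms subspace_add P)
  have "ip (scale c x - scale c (?P x)) s = 0" if "s \<in> S" for s
    using ip_scale_left[of c "x - ?P x" s] P(2)[OF that] by (simp add: scale_right_diff_distrib)
  then show "?P (scale c x) = scale c (?P x)"
    by (intro orthogonal_projection_eqI assms subspace_scale P)
qed

lemma norm_orthogonal_projection_le: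
  assumes "closed S" "subspace S"
  shows "norm (orthogonal_projection ip S x) \<le> norm x"
proof -
  let ?p = "orthogonal_projection ip S x"
  have "ip x ?p = ip ?p ?p"
    using orthogonal_projection_orthogonal[OF assms orthogonal_projection_in[OF assms]]
    by (simp add: ip_diff_left)
  then have "norm (ip ?p ?p) \<le> norm x * norm ?p"
    using cauchy_schwarz[of x ?p] by simp
  then have "norm ?p * norm ?p \<le> norm x * norm ?p"
    by (simp add: ip_self power2_eq_square norm_mult)
  then show ?thesis
    by (cases "norm ?p = 0") simp_all
qed

text \<open>
  The orthogonal complement of the orthogonal complement of \<open>M\<close> is the closure of \<open>M\<close>: the
  residual of \<open>x\<close> after projecting on that closure is orthogonal to \<open>M\<close> and hence to \<open>x\<close>,
  so it is orthogonal to itself.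
\<close>

lemma in_closure_if_orthogonal_to_complement:
  assumes "subspace M" "\<And>z. (\<And>m. m \<in> M \<Longrightarrow> ip z m = 0) \<Longrightarrow> ip x z = 0"
  shows "x \<in> closure M"
proof -
  note P = orthogonal_projection_in[OF closed_closure subspace_closure[OF assms(1)]]
    orthogonal_projection_orthogonal[OF closed_closure subspace_closure[OF assms(1)]]
  let ?p = "orthogonal_projection ip (closure M) x"
  have "ip x (x - ?p) = 0"
    using assms(2) P(2) closure_subset by blast
  moreover have "ip ?p (x - ?p) = 0"
    using P(2)[OF P(1)] by (simp add: ip_eq_zero_commute[of ?p])
  ultimately have "ip (x - ?p) (x - ?p) = 0"
    by (simp only: ip_diff_left[of x ?p "x - ?p"]) simp
  then have "x = ?p" by (simp add: ip_self_eq_zero)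
  then show ?thesis using P(1) by metis
qed

subsection \<open>Riesz representation and uniform boundedness\<close>

text \<open>
  The representing vector is a multiple of any nonzero vector \<open>u\<close> orthogonal to the kernel,
  since \<open>scale (\<phi> u) x - scale (\<phi> x) u\<close> lies in the kernel for every \<open>x\<close>.
\<close>

lemma riesz_representation:
  assumes "Vector_Spaces.linear scale (*) \<phi>" "continuous_on UNIV \<phi>"
  obtains y where "\<And>x. \<phi> x = ip x y"
proof (cases "\<forall>x. \<phi> x = 0")
  case True
  then show ?thesis using that[of 0] by simp
next
  case False
  interpret \<phi>: Vector_Spaces.linear scale "(*)" \<phi> by fact
  define S where "S = {x. \<phi> x = 0}"
  have S: "closed S" "subspace S"
    using continuous_closed_vimage[of "{0}" \<phi>] assms(2) \<phi>.subspace_kernel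
    by (simp_all add: S_def vimage_def continuous_on_eq_continuous_at)
  obtain v where v: "\<phi> v \<noteq> 0" using False by blast
  define u where "u = v - orthogonal_projection ip S v"
  have orth: "ip u s = 0" if "s \<in> S" for s
    using orthogonal_projection_orthogonal[OF S that] by (simp add: u_def)
  have "\<phi> u = \<phi> v"
    using orthogonal_projection_in[OF S, of v] by (simp add: u_def \<phi>.diff S_def)
  then have u: "u \<noteq> 0" "\<phi> u \<noteq> 0" using v \<phi>.zero by auto
  define y where "y = scale (scalar_cnj (\<phi> u / ip u u)) u"
  have cnj_cnj: "scalar_cnj (scalar_cnj c) = c" for c :: 'k
  proof (cases "c = 0")
    case True
    then show ?thesis using scalar_cnj_of_real[of 0, where 'k='k] by simp
  next
    case False
    have "c * scalar_cnj c = scalar_cnj (c * scalar_cnj c)"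
      unfolding mult_scalar_cnj scalar_cnj_of_real ..
    also have "\<dots> = scalar_cnj c * scalar_cnj (scalar_cnj c)" by (rule scalar_cnj_mult)
    finally have "scalar_cnj c = 0 \<or> scalar_cnj (scalar_cnj c) = c" by auto
    moreover have "scalar_cnj c \<noteq> 0"
      using mult_scalar_cnj[of c] False by auto
    ultimately show ?thesis by blast
  qed
  have "\<phi> x = ip x y" for x
  proof -
    have "scale (\<phi> u) x - scale (\<phi> x) u \<in> S"
      by (simp add: S_def \<phi>.diff \<phi>.scale)
    then have "ip (scale (\<phi> u) x - scale (\<phi> x) u) u = 0"
      using orth ip_eq_zero_commute by blast
    then have "\<phi> u * ip x u = \<phi> x * ip u u"
      by (simp add: ip_diff_left ip_scale_left)
    moreover have "ip u u \<noteq> 0" using u by (simp add: ip_self_eq_zero)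
    ultimately show ?thesis
      by (simp add: y_def ip_scale_right cnj_cnj field_simps)
  qed
  then show ?thesis by (rule that)
qed

text \<open>
  The uniform boundedness principle for the functionals \<open>\<lambda>x. ip x v\<close>: by Baire one of the sets
  on which they are all bounded by \<open>n\<close> contains a ball, and testing with \<open>v\<close> itself, scaled
  to fit in that ball, bounds \<open>norm v\<close>.
\<close>

lemma norm_bounded_if_weakly_bounded:
  assumes "\<And>x. \<exists>K. \<forall>v\<in>V. norm (ip x v) \<le> K"
  shows "\<exists>K. \<forall>v\<in>V. norm v \<le> K"
proof -
  define F where "F n = {x. \<forall>v\<in>V. norm (ip x v) \<le> real n}" for n
  have F_UN: "(\<Union>n. F n) = UNIV"
  proof -
    have "\<exists>n. x \<in> F n" for x :: 'h
    proof -
      obtain K where K: "\<forall>v\<in>V. norm (ip x v) \<le> K" using assms by blast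
      obtain n where "K \<le> real n" using real_arch_simple by blast
      with K have "x \<in> F n" unfolding F_def by fastforce
      then show ?thesis ..
    qed
    then show ?thesis by blast
  qed
  have closed: "closed (F n)" for n
  proof -
    have "F n = (\<Inter>v\<in>V. {x. norm (ip x v) \<le> real n})" unfolding F_def by blast
    then show ?thesis
      by (auto intro!: closed_INT closed_Collect_le continuous_intros
          bounded_linear.continuous_on[OF bounded_linear_ip_left])
  qed
  have "\<exists>n. interior (F n) \<noteq> {}"
  proof (rule ccontr)
    assume "\<not> ?thesis"
    then have "euclidean interior_of \<Union>(range F) = {}"
      using closed by (intro Baire_category_alt disjI1 completely_metrizable_space_euclidean) auto
    then show False using F_UN by simp
  qed
  then obtain n a where "a \<in> interior (F n)" by blast
  then obtain r where r: "0 < r" "cball a r \<subseteq> F n"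
    using mem_interior_cball by blast
  have "norm v \<le> 2 * real n / r" if "v \<in> V" for v
  proof (cases "v = 0")
    case False
    define w where "w = scale (of_real (r / norm v)) v"
    have "norm w = r" using r(1) False by (simp add: w_def norm_scale norm_divide)
    then have "a + w \<in> F n" "a \<in> F n" using r by (auto simp: dist_norm)
    then have "norm (ip (a + w) v) \<le> n" "norm (ip a v) \<le> n"
      using that by (auto simp: F_def)
    moreover have "ip w v = ip (a + w) v - ip a v" by (simp add: ip_add_left)
    ultimately have "norm (ip w v) \<le> 2 * n"
      using norm_triangle_ineq4[of "ip (a + w) v" "ip a v"] by simp
    moreover have "norm (ip w v) = r * norm v"
      using r(1) False
      by (simp add: w_def ip_scale_left ip_self norm_mult norm_divide power2_eq_square)
    ultimately show ?thesis using r(1) by (simp add: field_simps)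
  qed (use r in simp)
  then show ?thesis by blast
qed

end

section \<open>Continuous operators and their adjoints\<close>

locale hilbert_operator =
  dom: hilbert_space s1 ip1 + cod: hilbert_space s2 ip2
  for s1 :: "'k::real_or_complex \<Rightarrow> 'a::banach \<Rightarrow> 'a" and ip1
    and s2 :: "'k \<Rightarrow> 'b::banach \<Rightarrow> 'b" and ip2 +
  fixes T :: "'a \<Rightarrow> 'b"
  assumes continuous_linear: "continuous_linear s1 s2 T"
begin

sublocale Vector_Spaces.linear s1 s2 T
  using continuous_linear by (simp add: continuous_linear_def)

lemma tendsto: "u \<longlonglongrightarrow> x \<Longrightarrow> (\<lambda>n. T (u n)) \<longlonglongrightarrow> T x"
  using continuous_linear unfolding continuous_linear_def
  by (metis UNIV_I continuous_on_tendsto_compose eventually_sequentially)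

lemma bounded: obtains K where "0 \<le> K" "\<And>x. norm (T x) \<le> K * norm x"
proof -
  have "isCont T 0"
    using continuous_linear by (simp add: continuous_linear_def continuous_on_eq_continuous_at)
  then obtain d where d: "0 < d" "\<And>x. norm x < d \<Longrightarrow> norm (T x) < 1"
    unfolding continuous_at_eps_delta dist_norm using zero by (metis diff_zero zero_less_one)
  have "norm (T x) \<le> 2 / d * norm x" for x
  proof (cases "x = 0")
    case False
    let ?c = "of_real (d / (2 * norm x)) :: 'k"
    have "norm (s1 ?c x) < d"
      using d(1) False by (simp add: dom.norm_scale norm_divide norm_mult)
    then have "norm (s2 ?c (T x)) < 1" unfolding scale[symmetric] by (rule d(2))
    then show ?thesis
      using d(1) False by (simp add: cod.norm_scale norm_divide norm_mult field_simps)
  qed (simp add: zero)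
  then show ?thesis using that[of "2 / d"] d(1) by simp
qed

abbreviation adj where "adj \<equiv> hilbert_adjoint ip1 ip2 T"

lemma ip_adj: "ip2 (T x) y = ip1 x (adj y)"
proof -
  have "\<exists>z. \<forall>x. ip2 (T x) y = ip1 x z" for y
  proof (rule dom.riesz_representation)
    show "Vector_Spaces.linear s1 (*) (\<lambda>x. ip2 (T x) y)"
      unfolding Vector_Spaces.linear_iff
      by (auto simp: add scale cod.ip_add_left cod.ip_scale_left dom.vector_space_axioms
          intro!: vector_space.intro algebra_simps)
    show "continuous_on UNIV (\<lambda>x. ip2 (T x) y)"
      using continuous_linear unfolding continuous_linear_def
      by (intro bounded_linear.continuous_on[OF cod.bounded_linear_ip_left]) simp
  qed blast
  then obtain T' where T': "\<forall>x y. ip2 (T x) y = ip1 x (T' y)" by metis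
  have "\<exists>!T'. \<forall>x y. ip2 (T x) y = ip1 x (T' y)"
  proof (rule ex1I)
    show "\<forall>x y. ip2 (T x) y = ip1 x (T' y)" by (rule T')
    show "S = T'" if "\<forall>x y. ip2 (T x) y = ip1 x (S y)" for S
    proof
      fix y
      show "S y = T' y"
        by (rule dom.eq_if_ip_eq) (metis that T' dom.ip_commute)
    qed
  qed
  from theI'[OF this] show ?thesis unfolding hilbert_adjoint_def by blast
qed

lemma continuous_linear_adj: "continuous_linear s2 s1 adj"
  unfolding continuous_linear_def
proof
  have eqI: "u = v" if "\<And>x. ip1 x u = ip1 x v" for u v
    by (rule dom.eq_if_ip_eq) (metis that dom.ip_commute)
  have adj_add: "adj (x + y) = adj x + adj y" for x y
    by (rule eqI) (simp add: ip_adj[symmetric] dom.ip_add_right cod.ip_add_right)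
  have adj_scale: "adj (s2 c x) = s1 c (adj x)" for c x
    by (rule eqI) (simp add: ip_adj[symmetric] dom.ip_scale_right cod.ip_scale_right)
  show "Vector_Spaces.linear s2 s1 adj"
    unfolding Vector_Spaces.linear_iff
    by (simp add: adj_add adj_scale dom.vector_space_axioms cod.vector_space_axioms)
  obtain K where K: "0 \<le> K" "\<And>x. norm (T x) \<le> K * norm x" using bounded by blast
  have "norm (adj y) \<le> norm y * K" for y
  proof (cases "adj y = 0")
    case True
    then show ?thesis using K(1) by simp
  next
    case False
    have "norm (adj y) * norm (adj y) = norm (ip1 (adj y) (adj y))"
      by (simp add: dom.ip_self power2_eq_square norm_mult)
    also have "\<dots> \<le> norm (T (adj y)) * norm y"
      unfolding ip_adj[symmetric] by (rule cod.cauchy_schwarz)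
    also have "\<dots> \<le> K * norm (adj y) * norm y"
      by (intro mult_right_mono K(2)) simp
    finally show ?thesis using False by (simp add: mult.commute mult.left_commute)
  qed
  then have "bounded_linear adj"
    by (intro bounded_linear_intro)
       (auto simp: adj_add dom.scale_of_real[symmetric] cod.scale_of_real[symmetric] adj_scale)
  then show "continuous_on UNIV adj" by (rule linear_continuous_on)
qed

lemma hilbert_operator_adj: "hilbert_operator s2 ip2 s1 ip1 adj"
  by unfold_locales (rule continuous_linear_adj)

lemma closed_null_space: "closed (null_space T)"
  using continuous_closed_vimage[of "{0}" T] continuous_linear
  by (simp add: null_space_def vimage_def continuous_linear_def continuous_on_eq_continuous_at)

lemma subspace_null_space: "dom.subspace (null_space T)"
  unfolding null_space_def by (rule subspace_kernel)

text \<open>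
  A vector orthogonal to the range of \<open>adj\<close> is in the kernel of \<open>T\<close>, so a vector without component
  in the kernel is orthogonal to the complement of that range.
\<close>

lemma in_closure_range_adj_if_projection_eq_zero:
  assumes "orthogonal_projection ip1 (null_space T) x = 0"
  shows "x \<in> closure (range adj)"
proof (rule dom.in_closure_if_orthogonal_to_complement)
  interpret adj: hilbert_operator s2 ip2 s1 ip1 adj by (rule hilbert_operator_adj)
  show "dom.subspace (range adj)"
    by (intro adj.subspace_image cod.subspace_UNIV)
  show "ip1 x z = 0" if z: "\<And>m. m \<in> range adj \<Longrightarrow> ip1 z m = 0" for z
  proof -
    have "ip2 (T z) (T z) = 0" unfolding ip_adj using z by simp
    then have "z \<in> null_space T" by (simp add: null_space_def cod.ip_self_eq_zero)
    then show ?thesis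
      using dom.orthogonal_projection_orthogonal[OF closed_null_space subspace_null_space, of z x]
        assms by simp
  qed
qed

end

section \<open>Factoring one linear map through another\<close>

text \<open>
  A bound of \<open>T\<close> by \<open>S\<close> makes \<open>S h \<mapsto> T h\<close> a well-defined continuous map on the range of \<open>S\<close>.
  It extends by limits to the closure of that range and then, through the orthogonal projection
  on the closure, to the whole space. The relation \<open>rel\<close> is the graph of this extension.
\<close>

lemma continuous_factor_if_norm_le:
  assumes "hilbert_space s1 ip1" "hilbert_space s2 ip2"
    and "Vector_Spaces.linear s s1 S" "Vector_Spaces.linear s s2 T"
    and "0 \<le> C" "\<And>h. norm (T h) \<le> C * norm (S h)"
  obtains D where "continuous_linear s1 s2 D" "\<And>h. T h = D (S h)"
proof -
  interpret X: hilbert_space s1 ip1 by fact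
  interpret Y: hilbert_space s2 ip2 by fact
  interpret S: Vector_Spaces.linear s s1 S by fact
  interpret T: Vector_Spaces.linear s s2 T by fact
  define M where "M = closure (range S)"
  have M: "closed M" "X.subspace M"
    unfolding M_def by (auto intro!: X.subspace_closure S.subspace_image)
  define P where "P = orthogonal_projection ip1 M"
  interpret P: Vector_Spaces.linear s1 s1 P
    unfolding P_def by (rule X.linear_orthogonal_projection[OF M])
  define rel where "rel x z \<longleftrightarrow> (\<exists>u. (\<lambda>n. S (u n)) \<longlonglongrightarrow> P x \<and> (\<lambda>n. T (u n)) \<longlonglongrightarrow> z)" for x z
  have relI: "rel x z" if "(\<lambda>n. S (u n)) \<longlonglongrightarrow> P x" "(\<lambda>n. T (u n)) \<longlonglongrightarrow> z" for u x z
    using that unfolding rel_def by blast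
  have relE: thesis if "rel x z"
    "\<And>u. (\<lambda>n. S (u n)) \<longlonglongrightarrow> P x \<Longrightarrow> (\<lambda>n. T (u n)) \<longlonglongrightarrow> z \<Longrightarrow> thesis" for x z thesis
    using that unfolding rel_def by (elim exE conjE)
  have total: "\<exists>z. rel x z" for x
  proof -
    have "P x \<in> closure (range S)"
      using X.orthogonal_projection_in[OF M] by (simp add: P_def M_def)
    then obtain v where v: "\<And>n. v n \<in> range S" "v \<longlonglongrightarrow> P x"
      unfolding closure_sequential by blast
    have "\<forall>n. \<exists>h. v n = S h" using v(1) by blast
    then obtain u where "\<And>n. v n = S (u n)" by metis
    then have "v = (\<lambda>n. S (u n))" by (rule ext)
    with v(2) have u: "(\<lambda>n. S (u n)) \<longlonglongrightarrow> P x" by simp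
    have "Cauchy (\<lambda>n. T (u n))"
    proof (rule CauchyI)
      fix e :: real assume e: "0 < e"
      have "0 < e / (C + 1)" using e assms(5) by simp
      from CauchyD[OF LIMSEQ_imp_Cauchy[OF u] this] obtain N
        where N: "\<And>m n. N \<le> m \<Longrightarrow> N \<le> n \<Longrightarrow> norm (S (u m) - S (u n)) < e / (C + 1)" by blast
      have "norm (T (u m) - T (u n)) < e" if "N \<le> m" "N \<le> n" for m n
      proof -
        have "norm (T (u m) - T (u n)) \<le> C * norm (S (u m) - S (u n))"
          using assms(6)[of "u m - u n"] by (simp add: S.diff T.diff)
        also have "\<dots> \<le> (C + 1) * norm (S (u m) - S (u n))"
          by (intro mult_right_mono) simp_all
        also have "\<dots> < e"
          using N[OF that] assms(5) by (simp add: field_simps)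
        finally show ?thesis .
      qed
      then show "\<exists>N. \<forall>m\<ge>N. \<forall>n\<ge>N. norm (T (u m) - T (u n)) < e" by blast
    qed
    then obtain z where "(\<lambda>n. T (u n)) \<longlonglongrightarrow> z"
      using Cauchy_convergent_iff convergent_def by blast
    with u relI show ?thesis by blast
  qed
  have rel_add: "rel (x + y) (z + w)" if rels: "rel x z" "rel y w" for x y z w
  proof -
    obtain u where "(\<lambda>n. S (u n)) \<longlonglongrightarrow> P x" "(\<lambda>n. T (u n)) \<longlonglongrightarrow> z"
      by (rule relE[OF rels(1)])
    moreover obtain v where "(\<lambda>n. S (v n)) \<longlonglongrightarrow> P y" "(\<lambda>n. T (v n)) \<longlonglongrightarrow> w"
      by (rule relE[OF rels(2)])
    ultimately show ?thesis
      by (intro relI[of "\<lambda>n. u n + v n"]) (auto simp: S.add T.add P.add intro!: tendsto_add)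
  qed
  have rel_scale: "rel (s1 c x) (s2 c z)" if rel: "rel x z" for c x z
  proof -
    obtain u where "(\<lambda>n. S (u n)) \<longlonglongrightarrow> P x" "(\<lambda>n. T (u n)) \<longlonglongrightarrow> z"
      by (rule relE[OF rel])
    then show ?thesis
      by (intro relI[of "\<lambda>n. s c (u n)"])
        (auto simp: S.scale T.scale P.scale
          intro!: bounded_linear.tendsto[OF X.bounded_linear_scale]
            bounded_linear.tendsto[OF Y.bounded_linear_scale])
  qed
  have rel_bound: "norm z \<le> norm x * C" if rel: "rel x z" for x z
  proof -
    obtain u where u: "(\<lambda>n. S (u n)) \<longlonglongrightarrow> P x" "(\<lambda>n. T (u n)) \<longlonglongrightarrow> z"
      by (rule relE[OF rel])
    have "norm z \<le> C * norm (P x)"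
    proof (rule LIMSEQ_le)
      show "(\<lambda>n. norm (T (u n))) \<longlonglongrightarrow> norm z" by (intro tendsto_intros u)
      show "(\<lambda>n. C * norm (S (u n))) \<longlonglongrightarrow> C * norm (P x)" by (intro tendsto_intros u)
    qed (use assms(6) in blast)
    also have "\<dots> \<le> C * norm x"
      unfolding P_def by (intro mult_left_mono X.norm_orthogonal_projection_le M assms(5))
    finally show ?thesis by (simp add: mult.commute)
  qed
  have unique: "z = w" if "rel x z" "rel x w" for x z w
  proof -
    have "rel (x + s1 (- 1) x) (z + s2 (- 1) w)"
      by (intro rel_add rel_scale that)
    then have "rel 0 (z - w)" by simp
    from rel_bound[OF this] show ?thesis by simp
  qed
  from total obtain D where D: "\<And>x. rel x (D x)" by metis
  have D_add: "D (x + y) = D x + D y" for x y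
    using unique D rel_add by metis
  have D_scale: "D (s1 c x) = s2 c (D x)" for c x
    using unique D rel_scale by metis
  have "bounded_linear D"
    by (rule bounded_linear_intro[where K = C])
      (auto simp: D_add X.scale_of_real[symmetric] Y.scale_of_real[symmetric] D_scale
        intro!: rel_bound D)
  then have "continuous_linear s1 s2 D"
    unfolding continuous_linear_def Vector_Spaces.linear_iff
    by (simp add: D_add D_scale X.vector_space_axioms Y.vector_space_axioms linear_continuous_on)
  moreover have "T h = D (S h)" for h
  proof -
    have "S h \<in> M" unfolding M_def using closure_subset by (rule subsetD) simp
    then have "P (S h) = S h"
      unfolding P_def by (intro X.orthogonal_projection_eqI M) simp_all
    then have "rel (S h) (T h)" by (intro relI[of "\<lambda>_. h"]) simp_all
    then show ?thesis using unique D by blast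
  qed
  ultimately show ?thesis by (rule that)
qed

text \<open>
  Without continuity an inclusion of kernels suffices: \<open>D\<close> is \<open>T\<close> after a linear right inverse
  of \<open>S\<close> on its range, which a Hamel basis provides.
\<close>

lemma linear_factor_if_kernel_subset:
  assumes "Vector_Spaces.linear s s1 S" "Vector_Spaces.linear s s2 T"
    and "\<And>h. S h = 0 \<Longrightarrow> T h = 0"
  obtains D where "Vector_Spaces.linear s1 s2 D" "\<And>h. T h = D (S h)"
proof -
  interpret S: Vector_Spaces.linear s s1 S by fact
  interpret T: Vector_Spaces.linear s s2 T by fact
  interpret vector_space_pair s s1 ..
  obtain R where R: "Vector_Spaces.linear s1 s R" "\<And>v. v \<in> range S \<Longrightarrow> S (R v) = v"
    using linear_exists_right_inverse_on[OF assms(1) S.vs1.subspace_UNIV] by blast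
  have "T h = T (R (S h))" for h
    using assms(3)[of "h - R (S h)"] R(2)[of "S h"] by (simp add: S.diff T.diff)
  moreover have "Vector_Spaces.linear s1 s2 (T \<circ> R)"
    using R(1) assms(2) by (rule Vector_Spaces.linear_compose)
  ultimately show ?thesis using that by auto
qed

section \<open>The equivalence\<close>

locale operator_system =
  H1: hilbert_space s1 ip1 + H2: hilbert_space s2 ip2 +
  H4: hilbert_space s4 ip4 + H5: hilbert_space s5 ip5 +
  A1: hilbert_operator s1 ip1 s4 ip4 A1 + A2: hilbert_operator s1 ip1 s5 ip5 A2 +
  B1: hilbert_operator s2 ip2 s4 ip4 B1 + B2: hilbert_operator s2 ip2 s5 ip5 B2
  for s1 :: "'k::real_or_complex \<Rightarrow> 'h1::banach \<Rightarrow> 'h1" and ip1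
    and s2 :: "'k \<Rightarrow> 'h2::banach \<Rightarrow> 'h2" and ip2
    and s4 :: "'k \<Rightarrow> 'h4::banach \<Rightarrow> 'h4" and ip4
    and s5 :: "'k \<Rightarrow> 'h5::banach \<Rightarrow> 'h5" and ip5
    and A1 A2 B1 B2
begin

interpretation A1s: hilbert_operator s4 ip4 s1 ip1 A1.adj by (rule A1.hilbert_operator_adj)
interpretation A2s: hilbert_operator s5 ip5 s1 ip1 A2.adj by (rule A2.hilbert_operator_adj)
interpretation B1s: hilbert_operator s4 ip4 s2 ip2 B1.adj by (rule B1.hilbert_operator_adj)
interpretation B2s: hilbert_operator s5 ip5 s2 ip2 B2.adj by (rule B2.hilbert_operator_adj)

text \<open>
  If \<open>A1 h1 = B1 h2\<close>, then \<open>ip1 h1 (A1.adj h4) = ip2 h2 (B1.adj h4)\<close>, so on the set of all \<open>h4\<close>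
  with \<open>norm (B1.adj h4) \<le> 1\<close> the vectors \<open>A1.adj h4\<close> are weakly bounded, hence bounded.
\<close>

lemma adj_norm_le_if_range_subset:
  assumes "range A1 \<subseteq> range B1"
  shows "\<exists>C>0. \<forall>h4. norm (A1.adj h4) \<le> C * norm (B1.adj h4)"
proof -
  have "\<exists>K. \<forall>v\<in>A1.adj ` {h4. norm (B1.adj h4) \<le> 1}. norm v \<le> K"
  proof (rule H1.norm_bounded_if_weakly_bounded)
    fix h1
    obtain h2 where h2: "A1 h1 = B1 h2" using assms by blast
    have "norm (ip1 h1 (A1.adj h4)) \<le> norm h2" if "norm (B1.adj h4) \<le> 1" for h4
    proof -
      have "norm (ip1 h1 (A1.adj h4)) \<le> norm h2 * norm (B1.adj h4)"
        using H2.cauchy_schwarz by (simp only: A1.ip_adj[symmetric] h2 B1.ip_adj)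
      also have "\<dots> \<le> norm h2 * 1" using that by (intro mult_left_mono) simp_all
      finally show ?thesis by simp
    qed
    then show "\<exists>K. \<forall>v\<in>A1.adj ` {h4. norm (B1.adj h4) \<le> 1}. norm (ip1 h1 v) \<le> K" by blast
  qed
  then obtain K0 where K0: "\<And>h4. norm (B1.adj h4) \<le> 1 \<Longrightarrow> norm (A1.adj h4) \<le> K0" by blast
  define K where "K = max K0 1"
  have K: "0 < K" "\<And>h4. norm (B1.adj h4) \<le> 1 \<Longrightarrow> norm (A1.adj h4) \<le> K"
    using K0 by (force simp: K_def)+
  have "norm (A1.adj h4) \<le> K * norm (B1.adj h4)" for h4
  \<comment> \<open>dividing by numbers above \<open>norm (B1.adj h4)\<close> instead of by that norm covers the
    case \<open>B1.adj h4 = 0\<close>\<close>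
  proof (rule dense_ge)
    fix t assume t: "K * norm (B1.adj h4) < t"
    define r where "r = t / K"
    have r: "norm (B1.adj h4) < r" "t = K * r"
      using t K(1) by (simp_all add: r_def field_simps)
    then have r0: "0 < r" using norm_ge_zero[of "B1.adj h4"] by linarith
    let ?c = "of_real (1 / r) :: 'k"
    have "norm (B1.adj (s4 ?c h4)) \<le> 1"
      using r(1) r0 by (simp add: B1s.scale H2.norm_scale norm_divide)
    then have "norm (A1.adj (s4 ?c h4)) \<le> K" by (rule K(2))
    then show "norm (A1.adj h4) \<le> t"
      using r0 r(2) by (simp add: A1s.scale H1.norm_scale norm_divide field_simps)
  qed
  with K(1) show ?thesis by blast
qed

text \<open>
  The norm bound on \<open>A1.adj\<close> yields a continuous \<open>D1\<close> with \<open>A1.adj = D1 \<circ> B1.adj\<close>, so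
  \<open>A1.adj (y n)\<close> has the limit \<open>D1 (B2.adj h5)\<close>. It equals \<open>A2.adj h5\<close> because against \<open>h1\<close> both give \<open>ip2 h2 (B2.adj h5)\<close>, exactly for the limit
  and up to \<open>\<epsilon> * norm h5\<close> for \<open>A2.adj h5\<close>, with \<open>h2\<close> an approximate solution for \<open>h1\<close>.
\<close>

lemma adj_limit_if_approx_solvable:
  assumes approx: "\<And>h1 \<epsilon>. 0 < \<epsilon> \<Longrightarrow> \<exists>h2. A1 h1 = B1 h2 \<and> norm (A2 h1 - B2 h2) \<le> \<epsilon>"
    and y: "(\<lambda>n. B1.adj (y n)) \<longlonglongrightarrow> B2.adj h5"
  shows "(\<lambda>n. A1.adj (y n)) \<longlonglongrightarrow> A2.adj h5"
proof -
  have "range A1 \<subseteq> range B1" using approx[of 1] by fastforce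
  then obtain C where C: "0 < C" "\<And>h4. norm (A1.adj h4) \<le> C * norm (B1.adj h4)"
    using adj_norm_le_if_range_subset by blast
  obtain D1 where D1: "continuous_linear s2 s1 D1" "\<And>h4. A1.adj h4 = D1 (B1.adj h4)"
    by (rule continuous_factor_if_norm_le[OF H2.hilbert_space_axioms H1.hilbert_space_axioms
          B1s.linear_axioms A1s.linear_axioms less_imp_le[OF C(1)] C(2)])
      (rule that)
  interpret D1: hilbert_operator s2 ip2 s1 ip1 D1
    by unfold_locales (rule D1)
  let ?z = "D1 (B2.adj h5)"
  have z: "(\<lambda>n. A1.adj (y n)) \<longlonglongrightarrow> ?z"
    unfolding D1(2) by (rule D1.tendsto[OF y])
  have "ip1 ?z h1 = ip1 (A2.adj h5) h1" for h1
  proof -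
    have "norm (ip1 h1 ?z - ip1 h1 (A2.adj h5)) \<le> 0"
    proof (rule field_le_epsilon)
      fix e :: real assume e: "0 < e"
      define \<epsilon> where "\<epsilon> = e / (norm h5 + 1)"
      have \<epsilon>: "0 < \<epsilon>" using e by (simp add: \<epsilon>_def add_nonneg_pos)
      obtain h2 where h2: "A1 h1 = B1 h2" "norm (A2 h1 - B2 h2) \<le> \<epsilon>"
        using approx[OF \<epsilon>] by blast
      have "(\<lambda>n. ip1 h1 (A1.adj (y n))) \<longlonglongrightarrow> ip1 h1 ?z"
        by (rule bounded_linear.tendsto[OF H1.bounded_linear_ip_right z])
      moreover have "(\<lambda>n. ip1 h1 (A1.adj (y n))) \<longlonglongrightarrow> ip2 h2 (B2.adj h5)"
        unfolding A1.ip_adj[symmetric] h2(1) B1.ip_adj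
        by (rule bounded_linear.tendsto[OF H2.bounded_linear_ip_right y])
      ultimately have "ip1 h1 ?z = ip5 (B2 h2) h5"
        unfolding B2.ip_adj by (rule LIMSEQ_unique)
      then have "norm (ip1 h1 ?z - ip1 h1 (A2.adj h5)) = norm (ip5 (A2 h1 - B2 h2) h5)"
        by (simp add: H5.ip_diff_left A2.ip_adj[symmetric] norm_minus_commute)
      also have "\<dots> \<le> norm (A2 h1 - B2 h2) * norm h5" by (rule H5.cauchy_schwarz)
      also have "\<dots> \<le> \<epsilon> * (norm h5 + 1)" using h2(2) \<epsilon> by (intro mult_mono) simp_all
      also have "\<dots> = e"
        unfolding \<epsilon>_def using norm_ge_zero[of h5] by (simp add: add_nonneg_eq_0_iff)
      finally show "norm (ip1 h1 ?z - ip1 h1 (A2.adj h5)) \<le> 0 + e" by simp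
    qed
    then show ?thesis by (metis H1.ip_commute eq_iff_diff_eq_0 norm_le_zero_iff)
  qed
  then have "?z = A2.adj h5" by (rule H1.eq_if_ip_eq)
  with z show ?thesis by simp
qed

text \<open>
  Write \<open>\<Pi>\<close> for the orthogonal projection on the kernel of \<open>B1\<close>. Then \<open>D2\<close> must send \<open>\<Pi> (B2.adj h5)\<close> to \<open>A2.adj h5 - D1 (B2.adj h5)\<close>. The limit condition makes
  this well defined: if \<open>\<Pi> (B2.adj h5) = 0\<close>, then \<open>B2.adj h5\<close> is a limit of vectors
  \<open>B1.adj (y n)\<close>, and \<open>A1.adj (y n) = D1 (B1.adj (y n))\<close> tends both to \<open>A2.adj h5\<close> and to
  \<open>D1 (B2.adj h5)\<close>.
\<close>

lemma factorization_if_adj_conditions: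
  assumes C: "0 < C" "\<And>h4. norm (A1.adj h4) \<le> C * norm (B1.adj h4)"
    and lim: "\<And>h5 y. (\<lambda>n. B1.adj (y n)) \<longlonglongrightarrow> B2.adj h5 \<Longrightarrow> (\<lambda>n. A1.adj (y n)) \<longlonglongrightarrow> A2.adj h5"
  obtains D1 D2 where "continuous_linear s2 s1 D1" "Vector_Spaces.linear s2 s1 D2"
    "\<And>h4. A1.adj h4 = D1 (B1.adj h4)"
    "\<And>h5. A2.adj h5
      = D1 (B2.adj h5) + D2 (orthogonal_projection ip2 (null_space B1) (B2.adj h5))"
proof -
  obtain D1 where D1: "continuous_linear s2 s1 D1" "\<And>h4. A1.adj h4 = D1 (B1.adj h4)"
    by (rule continuous_factor_if_norm_le[OF H2.hilbert_space_axioms H1.hilbert_space_axioms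
          B1s.linear_axioms A1s.linear_axioms less_imp_le[OF C(1)] C(2)])
      (rule that)
  interpret D1: hilbert_operator s2 ip2 s1 ip1 D1
    by unfold_locales (rule D1)
  let ?P = "orthogonal_projection ip2 (null_space B1)"
  interpret P: Vector_Spaces.linear s2 s2 ?P
    by (rule H2.linear_orthogonal_projection[OF B1.closed_null_space B1.subspace_null_space])
  let ?Q = "\<lambda>h5. ?P (B2.adj h5)" and ?F = "\<lambda>h5. A2.adj h5 - D1 (B2.adj h5)"
  have Q: "Vector_Spaces.linear s5 s2 ?Q"
    unfolding Vector_Spaces.linear_iff
    by (simp add: B2s.add B2s.scale P.add P.scale H2.vector_space_axioms H5.vector_space_axioms)
  have F: "Vector_Spaces.linear s5 s1 ?F"
    unfolding Vector_Spaces.linear_iff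
    by (simp add: A2s.add A2s.scale B2s.add B2s.scale D1.add D1.scale
        H1.scale_right_diff_distrib H1.vector_space_axioms H5.vector_space_axioms)
  have ker: "?F h5 = 0" if "?Q h5 = 0" for h5
  proof -
    have "B2.adj h5 \<in> closure (range B1.adj)"
      using that by (rule B1.in_closure_range_adj_if_projection_eq_zero)
    then obtain v where v: "\<And>n. v n \<in> range B1.adj" "v \<longlonglongrightarrow> B2.adj h5"
      unfolding closure_sequential by blast
    have "\<forall>n. \<exists>h4. v n = B1.adj h4" using v(1) by blast
    then obtain y where "\<And>n. v n = B1.adj (y n)" by metis
    then have "v = (\<lambda>n. B1.adj (y n))" by (rule ext)
    with v(2) have y: "(\<lambda>n. B1.adj (y n)) \<longlonglongrightarrow> B2.adj h5" by simp
    have "(\<lambda>n. A1.adj (y n)) \<longlonglongrightarrow> D1 (B2.adj h5)"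
      unfolding D1(2) by (rule D1.tendsto[OF y])
    then show ?thesis using LIMSEQ_unique lim[OF y] by auto
  qed
  obtain D2 where D2: "Vector_Spaces.linear s2 s1 D2" "\<And>h5. ?F h5 = D2 (?Q h5)"
    by (rule linear_factor_if_kernel_subset[OF Q F], erule ker, rule that)
  have "A2.adj h5 = D1 (B2.adj h5) + D2 (?P (B2.adj h5))" for h5
    unfolding D2(2)[symmetric] by simp
  from D1(1) D2(1) D1(2) this show ?thesis by (rule that)
qed

text \<open>
  Taking adjoints in \<open>A1.adj = D1 \<circ> B1.adj\<close> shows that \<open>D1.adj h1\<close> solves \<open>A1 h1 = B1 h2\<close>
  exactly; every other solution differs from it by some \<open>n\<close> in the kernel of \<open>B1\<close>. What remains to
  approximate, \<open>A2 h1 - B2 (D1.adj h1)\<close>, is in the closure of the image of this kernel under \<open>B2\<close>: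
  if \<open>z\<close> is orthogonal to the image, then \<open>B2.adj z\<close> is orthogonal to the kernel, so the term with
  \<open>D2\<close> vanishes and \<open>A2.adj z = D1 (B2.adj z)\<close>.
\<close>

lemma approx_solvable_if_factorization:
  assumes D1: "continuous_linear s2 s1 D1" "\<And>h4. A1.adj h4 = D1 (B1.adj h4)"
    and D2: "D2 0 = 0"
      "\<And>h5. A2.adj h5
        = D1 (B2.adj h5) + D2 (orthogonal_projection ip2 (null_space B1) (B2.adj h5))"
    and "0 < \<epsilon>"
  shows "\<exists>h2. A1 h1 = B1 h2 \<and> norm (A2 h1 - B2 h2) \<le> \<epsilon>"
proof -
  interpret D1: hilbert_operator s2 ip2 s1 ip1 D1
    by unfold_locales (rule D1)
  let ?E = "hilbert_adjoint ip2 ip1 D1"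
  have ip_E: "ip2 (?E h1) x = ip1 h1 (D1 x)" for x
    by (metis D1.ip_adj H1.ip_commute H2.ip_commute)
  have solution: "A1 h1 = B1 (?E h1)"
    by (rule H4.eq_if_ip_eq) (simp add: A1.ip_adj B1.ip_adj ip_E D1(2))
  let ?v = "A2 h1 - B2 (?E h1)"
  have "?v \<in> closure (B2 ` null_space B1)"
  proof (rule H5.in_closure_if_orthogonal_to_complement)
    show "H5.subspace (B2 ` null_space B1)"
      by (rule B2.subspace_image[OF B1.subspace_null_space])
    show "ip5 ?v z = 0" if z: "\<And>m. m \<in> B2 ` null_space B1 \<Longrightarrow> ip5 z m = 0" for z
    proof -
      have "ip2 (B2.adj z) n = 0" if "n \<in> null_space B1" for n
        using z[OF imageI[OF that]] B2.ip_adj H2.ip_eq_zero_commute H5.ip_eq_zero_commute by metis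
      then have "orthogonal_projection ip2 (null_space B1) (B2.adj z) = 0"
        by (intro H2.orthogonal_projection_eqI B1.subspace_null_space H2.subspace_0) simp_all
      then have "A2.adj z = D1 (B2.adj z)" using D2 by simp
      then show ?thesis
        by (simp add: H5.ip_diff_left A2.ip_adj B2.ip_adj ip_E)
    qed
  qed
  then obtain n where n: "n \<in> null_space B1" "dist (B2 n) ?v < \<epsilon>"
    using assms(5) unfolding closure_approachable by blast
  have "A1 h1 = B1 (?E h1 + n)"
    using n(1) solution by (simp add: B1.add null_space_def)
  moreover have "norm (A2 h1 - B2 (?E h1 + n)) \<le> \<epsilon>"
    using n(2) by (simp add: B2.add dist_norm norm_minus_commute algebra_simps)
  ultimately show ?thesis by blast
qed

end

theorem theorem2p1:
  fixes s1 :: "'k::real_or_complex \<Rightarrow> 'h1::banach \<Rightarrow> 'h1" and ip1 :: "'h1 \<Rightarrow> 'h1 \<Rightarrow> 'k"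
    and s2 :: "'k \<Rightarrow> 'h2::banach \<Rightarrow> 'h2" and ip2 :: "'h2 \<Rightarrow> 'h2 \<Rightarrow> 'k"
    and s4 :: "'k \<Rightarrow> 'h4::banach \<Rightarrow> 'h4" and ip4 :: "'h4 \<Rightarrow> 'h4 \<Rightarrow> 'k"
    and s5 :: "'k \<Rightarrow> 'h5::banach \<Rightarrow> 'h5" and ip5 :: "'h5 \<Rightarrow> 'h5 \<Rightarrow> 'k"
    and A1 :: "'h1 \<Rightarrow> 'h4" and A2 :: "'h1 \<Rightarrow> 'h5"
    and B1 :: "'h2 \<Rightarrow> 'h4" and B2 :: "'h2 \<Rightarrow> 'h5"
  assumes "hilbert_space s1 ip1" and "hilbert_space s2 ip2"
    and "hilbert_space s4 ip4" and "hilbert_space s5 ip5"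
    and "continuous_linear s1 s4 A1" and "continuous_linear s1 s5 A2"
    and "continuous_linear s2 s4 B1" and "continuous_linear s2 s5 B2"
  defines "A1s \<equiv> hilbert_adjoint ip1 ip4 A1" and "A2s \<equiv> hilbert_adjoint ip1 ip5 A2"
    and "B1s \<equiv> hilbert_adjoint ip2 ip4 B1" and "B2s \<equiv> hilbert_adjoint ip2 ip5 B2"
    and "Proj \<equiv> orthogonal_projection ip2 (null_space B1)"
  defines "stmt_i \<equiv>
      (\<forall>h1. \<forall>\<epsilon>>0. \<exists>h2. A1 h1 = B1 h2 \<and> norm (A2 h1 - B2 h2) \<le> \<epsilon>)"
    and "stmt_ii \<equiv>
      (\<exists>C>0. \<forall>h4. norm (A1s h4) \<le> C * norm (B1s h4)) \<and>
      (\<forall>h5. \<forall>y :: nat \<Rightarrow> 'h4.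
        (\<lambda>n. B1s (y n)) \<longlonglongrightarrow> B2s h5 \<longrightarrow> (\<lambda>n. A1s (y n)) \<longlonglongrightarrow> A2s h5)"
    and "stmt_iii \<equiv>
      (\<exists>D1 D2. continuous_linear s2 s1 D1 \<and> linear_on_subspace s2 s1 (null_space B1) D2 \<and>
        A1s = (\<lambda>h4. D1 (B1s h4)) \<and>
        A2s = (\<lambda>h5. D1 (B2s h5) + D2 (Proj (B2s h5))))"
  shows "(stmt_i \<longleftrightarrow> stmt_ii) \<and> (stmt_ii \<longleftrightarrow> stmt_iii)"
proof -
  interpret operator_system s1 ip1 s2 ip2 s4 ip4 s5 ip5 A1 A2 B1 B2
    using assms(1-8)
    by (intro operator_system.intro hilbert_operator.intro hilbert_operator_axioms.intro)
  have "stmt_ii" if "stmt_i"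
  proof -
    from that have approx: "\<And>h1 \<epsilon>. 0 < \<epsilon> \<Longrightarrow> \<exists>h2. A1 h1 = B1 h2 \<and> norm (A2 h1 - B2 h2) \<le> \<epsilon>"
      unfolding stmt_i_def by blast
    then have "range A1 \<subseteq> range B1" by (metis image_subsetI rangeI zero_less_one)
    then show ?thesis
      unfolding stmt_ii_def A1s_def A2s_def B1s_def B2s_def
      using adj_norm_le_if_range_subset adj_limit_if_approx_solvable[OF approx] by blast
  qed
  moreover have "stmt_iii" if "stmt_ii"
  proof -
    from that obtain C where C: "0 < C" "\<And>h4. norm (A1s h4) \<le> C * norm (B1s h4)"
      "\<And>h5 y. (\<lambda>n. B1s (y n)) \<longlonglongrightarrow> B2s h5 \<Longrightarrow> (\<lambda>n. A1s (y n)) \<longlonglongrightarrow> A2s h5"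
      unfolding stmt_ii_def by blast
    obtain D1 D2 where D: "continuous_linear s2 s1 D1" "Vector_Spaces.linear s2 s1 D2"
      "\<And>h4. A1s h4 = D1 (B1s h4)" "\<And>h5. A2s h5 = D1 (B2s h5) + D2 (Proj (B2s h5))"
      using factorization_if_adj_conditions[OF C[unfolded A1s_def A2s_def B1s_def B2s_def]]
      unfolding A1s_def A2s_def B1s_def B2s_def Proj_def by blast
    then have "linear_on_subspace s2 s1 (null_space B1) D2"
      unfolding linear_on_subspace_def Vector_Spaces.linear_iff by blast
    with D show ?thesis unfolding stmt_iii_def by blast
  qed
  moreover have "stmt_i" if "stmt_iii"
  proof -
    from that obtain D1 D2 where D: "continuous_linear s2 s1 D1"
      "linear_on_subspace s2 s1 (null_space B1) D2"
      "\<And>h4. A1s h4 = D1 (B1s h4)" "\<And>h5. A2s h5 = D1 (B2s h5) + D2 (Proj (B2s h5))"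
      unfolding stmt_iii_def by (metis (no_types, lifting))
    have "D2 (s2 0 0) = s1 0 (D2 0)"
      using D(2) H2.subspace_0[OF B1.subspace_null_space]
      unfolding linear_on_subspace_def by blast
    then have "D2 0 = 0" by simp
    from approx_solvable_if_factorization[OF D(1) D(3)[unfolded A1s_def B1s_def] this
        D(4)[unfolded A2s_def B2s_def Proj_def]]
    show ?thesis unfolding stmt_i_def by blast
  qed
  ultimately show ?thesis by blast
qed

end
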